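(* Let $A, B \geq 1$ be integers, and let $F_A(u_1, \dots, u_A)$ and $F_B(v_1, \dots, v_B)$ be two real-valued $C^2$ functions, in independent sets of variables, defined on open subsets of $\mathbb{R}^A$ and $\mathbb{R}^B$ respectively. For real constants $\mu_A$ and $\mu_B$, define $$F(u_1, \dots, u_A, v_1, \dots, v_B) := \mu_A^{1/3} F_A(u_1, \dots, u_A) + \mu_B^{1/3} F_B(v_1, \dots, v_B),$$ where $\mu^{1/3}$ denotes the real cube root. Then $$\Delta_{\infty, \mathbb{R}^{A+B}} F = \mu_A \, \Delta_{\infty, \mathbb{R}^A} F_A + \mu_B \, \Delta_{\infty, \mathbb{R}^B} F_B .$$
   Context: For a $C^2$ function $G$ on an open subset of $\mathbb{R}^N$, the infinity Laplacian is $$\Delta_{\infty, \mathbb{R}^N} G := \left\langle \nabla G, \nabla\left(\tfrac12 \|\nabla G\|^2\right)\right\rangle_{\mathbb{R}^N}.$$ *)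

theory Defs
  imports "HOL-Analysis.Analysis"
begin

definition C2_on :: "'a::real_normed_vector set \<Rightarrow> ('a \<Rightarrow> 'b::real_normed_vector) \<Rightarrow> bool" where
  "C2_on U f \<longleftrightarrow>
     (\<exists>(f' :: 'a \<Rightarrow> 'a \<Rightarrow>\<^sub>L 'b) (f'' :: 'a \<Rightarrow> 'a \<Rightarrow>\<^sub>L ('a \<Rightarrow>\<^sub>L 'b)).
        (\<forall>x\<in>U. (f has_derivative blinfun_apply (f' x)) (at x)) \<and>
        (\<forall>x\<in>U. (f' has_derivative blinfun_apply (f'' x)) (at x)) \<and>
        continuous_on U f'')"

text \<open>As with \<^const>\<open>deriv\<close>, the value is unspecified where \<open>f\<close> is not differentiable.\<close>

definition gradient :: "('a::real_inner \<Rightarrow> real) \<Rightarrow> 'a \<Rightarrow> 'a" where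
  "gradient f x = (THE D. GDERIV f x :> D)"

lemma gradient_eqI: "GDERIV f x :> D \<Longrightarrow> gradient f x = D"
proof -
  assume D: "GDERIV f x :> D"
  have "D' = D" if "GDERIV f x :> D'" for D'
  proof -
    have "(\<lambda>h. inner h D') = (\<lambda>h. inner h D)"
      using has_derivative_unique that D unfolding gderiv_def by blast
    then have "inner (D' - D) D' = inner (D' - D) D"
      by (rule fun_cong)
    then have "inner (D' - D) (D' - D) = 0"
      by (simp add: inner_diff_right)
    then show "D' = D"
      by simp
  qed
  with D show ?thesis
    unfolding gradient_def by blast
qed

definition inf_laplacian :: "('a::euclidean_space \<Rightarrow> real) \<Rightarrow> 'a \<Rightarrow> real" where
  "inf_laplacian G x = inner (gradient G x) (gradient (\<lambda>y. 1/2 * (norm (gradient G y))\<^sup>2) x)"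

text \<open>
  Coordinates on \<open>\<real>\<^bsup>A+B\<^esup>\<close> are indexed by the disjoint sum of the two index types: the
  \<open>Inl\<close> coordinates are the \<open>u\<^sub>i\<close>, the \<open>Inr\<close> coordinates are the \<open>v\<^sub>j\<close>.
\<close>

definition u_part :: "real ^ ('a::finite + 'b::finite) \<Rightarrow> real ^ 'a" where
  "u_part w = (\<chi> i. w $ Inl i)"

definition v_part :: "real ^ ('a::finite + 'b::finite) \<Rightarrow> real ^ 'b" where
  "v_part w = (\<chi> j. w $ Inr j)"

end

theory Submission
  imports Defs
begin

text \<open>
  In the coordinates \<open>w = (u, v)\<close>, the gradient of a function
  \<open>c * f(u) + d * g(v)\<close> is the vector whose two blocks are \<open>c * \<nabla>f(u)\<close> and
  \<open>d * \<nabla>g(v)\<close> (\<open>gderiv_separated\<close>), and the blocks are orthogonal. This is used twice.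
  Write \<open>a\<close> and \<open>b\<close> for the cube roots of \<open>\<mu>\<^sub>A\<close> and \<open>\<mu>\<^sub>B\<close>. First, \<open>\<nabla>F\<close> has the blocks
  \<open>a * \<nabla>F\<^sub>A\<close> and \<open>b * \<nabla>F\<^sub>B\<close>, so that
  \<open>\<parallel>\<nabla>F\<parallel>\<^sup>2 / 2\<close> is again a separated function, with coefficients \<open>a\<^sup>2\<close> and \<open>b\<^sup>2\<close>.
  Second, the gradient of that function has blocks with factors \<open>a\<^sup>2\<close> and \<open>b\<^sup>2\<close>. The inner
  product of the two gradients therefore carries the factors \<open>a\<^sup>3 = \<mu>\<^sub>A\<close> and
  \<open>b\<^sup>3 = \<mu>\<^sub>B\<close>, without cross terms: the infinity Laplacian is homogeneous of degree three.

  The \<open>C\<^sup>2\<close> hypothesis guarantees that \<open>F\<^sub>A\<close>, \<open>F\<^sub>B\<close> and their half squared gradient norms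
  really have gradients, so that none of the values in question is a default value.
\<close>

lemma has_derivative_imp_gderiv_gradient:
  fixes f :: "'a::euclidean_space \<Rightarrow> real"
  assumes "(f has_derivative D) (at x)"
  shows "GDERIV f x :> gradient f x"
proof -
  interpret D: bounded_linear D
    using assms by (rule has_derivative_bounded_linear)
  \<comment> \<open>the Riesz representative of the derivative\<close>
  define r where "r = (\<Sum>b\<in>Basis. D b *\<^sub>R b)"
  have "D h = inner h r" for h
  proof -
    have "D h = D (\<Sum>b\<in>Basis. (h \<bullet> b) *\<^sub>R b)"
      by (simp add: euclidean_representation)
    also have "\<dots> = inner h r"
      by (simp add: r_def D.sum D.scaleR inner_sum_right mult.commute)
    finally show ?thesis .
  qed
  then have "D = (\<lambda>h. inner h r)" by (rule ext)
  with assms have "GDERIV f x :> r"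
    by (simp add: gderiv_def)
  then show ?thesis
    using gradient_eqI by metis
qed

lemma gderiv_transform_open:
  assumes "GDERIV f x :> D" "open S" "x \<in> S" "\<And>y. y \<in> S \<Longrightarrow> f y = g y"
  shows "GDERIV g x :> D"
  using assms unfolding gderiv_def by (rule has_derivative_transform_within_open)

lemma C2_on_gderiv:
  fixes f :: "'a::euclidean_space \<Rightarrow> real"
  assumes "C2_on U f" "x \<in> U"
  shows "GDERIV f x :> gradient f x"
  using assms unfolding C2_on_def by (blast intro: has_derivative_imp_gderiv_gradient)

text \<open>
  By Parseval, \<open>\<parallel>\<nabla>f\<parallel>\<^sup>2\<close> is the sum of the squares of the partial derivatives, which are
  differentiable because \<open>f\<close> is \<open>C\<^sup>2\<close>. Openness of \<open>U\<close> makes this identity hold near \<open>x\<close>.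
\<close>

lemma C2_on_gderiv_half_norm_gradient:
  fixes f :: "'a::euclidean_space \<Rightarrow> real"
  assumes "open U" "C2_on U f" "x \<in> U"
  defines "H \<equiv> \<lambda>y. 1/2 * (norm (gradient f y))\<^sup>2"
  shows "GDERIV H x :> gradient H x"
proof -
  obtain f' :: "'a \<Rightarrow> 'a \<Rightarrow>\<^sub>L real" and f'' :: "'a \<Rightarrow> 'a \<Rightarrow>\<^sub>L ('a \<Rightarrow>\<^sub>L real)"
    where f': "\<And>y. y \<in> U \<Longrightarrow> (f has_derivative blinfun_apply (f' y)) (at y)"
      and f'': "\<And>y. y \<in> U \<Longrightarrow> (f' has_derivative blinfun_apply (f'' y)) (at y)"
    using assms(2) unfolding C2_on_def by blast
  have partial: "f' y b = gradient f y \<bullet> b" if "y \<in> U" for y b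
  proof -
    have "(f has_derivative (\<lambda>h. h \<bullet> gradient f y)) (at y)"
      using C2_on_gderiv[OF assms(2) that] by (simp add: gderiv_def)
    with f'[OF that] have "blinfun_apply (f' y) = (\<lambda>h. h \<bullet> gradient f y)"
      by (rule has_derivative_unique)
    then show ?thesis
      by (simp add: inner_commute)
  qed
  have "((\<lambda>y. 1/2 * (\<Sum>b\<in>Basis. f' y b * f' y b)) has_derivative
      (\<lambda>h. 1/2 * (\<Sum>b\<in>Basis. f' x b * f'' x h b + f'' x h b * f' x b))) (at x)"
    by (intro has_derivative_mult_right has_derivative_sum has_derivative_mult
        bounded_linear.has_derivative[OF bounded_linear_apply_blinfun] f'' assms)
  moreover have "1/2 * (\<Sum>b\<in>Basis. f' y b * f' y b) = H y" if "y \<in> U" for y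
    unfolding H_def power2_norm_eq_inner partial[OF that]
    using euclidean_inner[of "gradient f y" "gradient f y"] by simp
  ultimately have "(H has_derivative
      (\<lambda>h. 1/2 * (\<Sum>b\<in>Basis. f' x b * f'' x h b + f'' x h b * f' x b))) (at x)"
    using has_derivative_transform_within_open assms(1,3) by blast
  then show ?thesis
    by (rule has_derivative_imp_gderiv_gradient)
qed

lemma bounded_linear_u_part: "bounded_linear u_part"
  unfolding linear_conv_bounded_linear[symmetric]
  by (intro linearI) (simp_all add: u_part_def vec_eq_iff)

lemma bounded_linear_v_part: "bounded_linear v_part"
  unfolding linear_conv_bounded_linear[symmetric]
  by (intro linearI) (simp_all add: v_part_def vec_eq_iff)

definition join_parts :: "real ^ 'a \<Rightarrow> real ^ 'b \<Rightarrow> real ^ ('a::finite + 'b::finite)" where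
  "join_parts p q = (\<chi> s. case s of Inl i \<Rightarrow> p $ i | Inr j \<Rightarrow> q $ j)"

lemma u_part_join_parts [simp]: "u_part (join_parts p q) = p"
  by (simp add: u_part_def join_parts_def vec_eq_iff)

lemma v_part_join_parts [simp]: "v_part (join_parts p q) = q"
  by (simp add: v_part_def join_parts_def vec_eq_iff)

lemma inner_parts: "x \<bullet> y = u_part x \<bullet> u_part y + v_part x \<bullet> v_part y"
  unfolding inner_vec_def u_part_def v_part_def
  by (simp add: UNIV_Plus_UNIV[symmetric] sum.Plus del: UNIV_Plus_UNIV)

lemma gderiv_separated:
  assumes f: "GDERIV f (u_part w) :> p" and g: "GDERIV g (v_part w) :> q"
  shows "GDERIV (\<lambda>y. c * f (u_part y) + d * g (v_part y)) w :>
           join_parts (c *\<^sub>R p) (d *\<^sub>R q)"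
proof -
  have "((\<lambda>y. f (u_part y)) has_derivative (\<lambda>h. u_part h \<bullet> p)) (at w)"
    using has_derivative_compose[OF bounded_linear_imp_has_derivative[OF bounded_linear_u_part]]
      f unfolding gderiv_def by blast
  moreover have "((\<lambda>y. g (v_part y)) has_derivative (\<lambda>h. v_part h \<bullet> q)) (at w)"
    using has_derivative_compose[OF bounded_linear_imp_has_derivative[OF bounded_linear_v_part]]
      g unfolding gderiv_def by blast
  ultimately have "((\<lambda>y. c * f (u_part y) + d * g (v_part y)) has_derivative
      (\<lambda>h. c * (u_part h \<bullet> p) + d * (v_part h \<bullet> q))) (at w)"
    by (intro has_derivative_add has_derivative_mult_right)
  then show ?thesis
    by (simp add: gderiv_def inner_parts[of _ "join_parts _ _"])
qed

theorem lemma3: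
  fixes U :: "(real ^ 'a::finite) set" and V :: "(real ^ 'b::finite) set"
    and F\<^sub>A :: "real ^ 'a \<Rightarrow> real" and F\<^sub>B :: "real ^ 'b \<Rightarrow> real"
    and \<mu>\<^sub>A \<mu>\<^sub>B :: real
    and F :: "real ^ ('a + 'b) \<Rightarrow> real"
    and w :: "real ^ ('a + 'b)"
  assumes "open U" and "C2_on U F\<^sub>A"
    and "open V" and "C2_on V F\<^sub>B"
    and "\<And>w. u_part w \<in> U \<Longrightarrow> v_part w \<in> V \<Longrightarrow>
           F w = root 3 \<mu>\<^sub>A * F\<^sub>A (u_part w) + root 3 \<mu>\<^sub>B * F\<^sub>B (v_part w)"
    and "u_part w \<in> U" and "v_part w \<in> V"
  shows "inf_laplacian F w =
           \<mu>\<^sub>A * inf_laplacian F\<^sub>A (u_part w) + \<mu>\<^sub>B * inf_laplacian F\<^sub>B (v_part w)"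
proof -
  define a where "a = root 3 \<mu>\<^sub>A"
  define b where "b = root 3 \<mu>\<^sub>B"
  have a3: "a * a\<^sup>2 = \<mu>\<^sub>A" and b3: "b * b\<^sup>2 = \<mu>\<^sub>B"
    using odd_real_root_pow[of 3 \<mu>\<^sub>A] odd_real_root_pow[of 3 \<mu>\<^sub>B]
    by (simp_all add: a_def b_def power3_eq_cube power2_eq_square mult.assoc)
  define W where "W = {y :: real ^ ('a + 'b). u_part y \<in> U \<and> v_part y \<in> V}"
  have "W = u_part -` U \<inter> v_part -` V"
    by (auto simp: W_def)
  then have W: "open W"
    using assms(1,3) bounded_linear_u_part bounded_linear_v_part
    by (auto intro!: open_Int open_vimage linear_continuous_on)
  have w: "w \<in> W"
    using assms(6,7) by (simp add: W_def)
  have gradF: "gradient F y =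
      join_parts (a *\<^sub>R gradient F\<^sub>A (u_part y)) (b *\<^sub>R gradient F\<^sub>B (v_part y))"
    if y: "y \<in> W" for y
  proof (rule gradient_eqI)
    from y have uv: "u_part y \<in> U" "v_part y \<in> V"
      by (simp_all add: W_def)
    show "GDERIV F y :>
        join_parts (a *\<^sub>R gradient F\<^sub>A (u_part y)) (b *\<^sub>R gradient F\<^sub>B (v_part y))"
      using gderiv_separated[OF C2_on_gderiv[OF assms(2) uv(1)] C2_on_gderiv[OF assms(4) uv(2)]]
        W y
      by (rule gderiv_transform_open) (simp add: assms(5) W_def a_def b_def)
  qed
  define H where "H = (\<lambda>y. 1/2 * (norm (gradient F y))\<^sup>2)"
  define H\<^sub>A where "H\<^sub>A = (\<lambda>x. 1/2 * (norm (gradient F\<^sub>A x))\<^sup>2)"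
  define H\<^sub>B where "H\<^sub>B = (\<lambda>x. 1/2 * (norm (gradient F\<^sub>B x))\<^sup>2)"
  have H_sep: "a\<^sup>2 * H\<^sub>A (u_part y) + b\<^sup>2 * H\<^sub>B (v_part y) = H y" if "y \<in> W" for y
    unfolding H_def H\<^sub>A_def H\<^sub>B_def gradF[OF that] power2_norm_eq_inner
      inner_parts[of "join_parts _ _"]
    by (simp add: power2_eq_square algebra_simps)
  have gradH: "gradient H w =
      join_parts (a\<^sup>2 *\<^sub>R gradient H\<^sub>A (u_part w)) (b\<^sup>2 *\<^sub>R gradient H\<^sub>B (v_part w))"
  proof (rule gradient_eqI)
    have "GDERIV H\<^sub>A (u_part w) :> gradient H\<^sub>A (u_part w)"
      unfolding H\<^sub>A_def by (rule C2_on_gderiv_half_norm_gradient[OF assms(1,2,6)])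
    moreover have "GDERIV H\<^sub>B (v_part w) :> gradient H\<^sub>B (v_part w)"
      unfolding H\<^sub>B_def by (rule C2_on_gderiv_half_norm_gradient[OF assms(3,4,7)])
    ultimately have "GDERIV (\<lambda>y. a\<^sup>2 * H\<^sub>A (u_part y) + b\<^sup>2 * H\<^sub>B (v_part y)) w :>
        join_parts (a\<^sup>2 *\<^sub>R gradient H\<^sub>A (u_part w)) (b\<^sup>2 *\<^sub>R gradient H\<^sub>B (v_part w))"
      by (rule gderiv_separated)
    then show "GDERIV H w :>
        join_parts (a\<^sup>2 *\<^sub>R gradient H\<^sub>A (u_part w)) (b\<^sup>2 *\<^sub>R gradient H\<^sub>B (v_part w))"
      using W w H_sep by (rule gderiv_transform_open)
  qed
  have "inf_laplacian F w = gradient F w \<bullet> gradient H w"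
    by (simp add: inf_laplacian_def H_def)
  also have "\<dots> = (a * a\<^sup>2) * (gradient F\<^sub>A (u_part w) \<bullet> gradient H\<^sub>A (u_part w))
      + (b * b\<^sup>2) * (gradient F\<^sub>B (v_part w) \<bullet> gradient H\<^sub>B (v_part w))"
    by (simp add: gradF[OF w] gradH inner_parts[of "join_parts _ _"])
  also have "\<dots> = \<mu>\<^sub>A * inf_laplacian F\<^sub>A (u_part w) + \<mu>\<^sub>B * inf_laplacian F\<^sub>B (v_part w)"
    unfolding a3 b3 by (simp add: inf_laplacian_def H\<^sub>A_def H\<^sub>B_def)
  finally show ?thesis .
qed

end
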